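(* For integers $b>1$ let $c_b(n)$ be the number of convex domino towers consisting of $n$ dominoes whose row of maximum length has $b$ dominoes. The numbers $c_b(n)$ are of exponential order $2^n$: for each $b>1$ there is a nonzero constant $\theta_b$ (independent of $n$) such that $$c_b(n)\sim \theta_b\, 2^n\qquad (n\to\infty).$$
   Context: Cells are unit squares indexed by $(x,y)\in\mathbb{Z}^2$; a domino occupies a pair of cells $\{(x,y),(x+1,y)\}$; dominoes in a configuration do not overlap. For $n\ge b'\ge 1$, an $(n,b')$-domino tower is a polyomino (counted up to translation only) created by taking a base of $b'$ consecutive dominoes in a single row (a contiguous horizontal strip of $2b'$ cells) and sequentially placing $n-b'$ further horizontal dominoes so that if a non-base domino is placed at $\{(x,y),(x+1,y)\}$ then there is a domino at $\{(x-1,y-1),(x,y-1)\}$, $\{(x,y-1),(x+1,y-1)\}$ or $\{(x+1,y-1),(x+2,y-1)\}$. A domino tower is an $(n,b')$-domino tower for some $n,b'$. A row (column) is the intersection of the polyomino with an infinite horizontal (vertical) line of unit squares; the tower is convex if every row and every column consists of consecutive cells. The length of a row is its number of dominoes. Here $u_n\sim v_n$ means $u_n/v_n\to1$. *)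

theory Defs
  imports "HOL-Library.Product_Plus" "HOL-Library.Landau_Symbols"
begin

type_synonym cell = "int \<times> int"

definition domino :: "int \<Rightarrow> int \<Rightarrow> cell set" where
  "domino x y = {(x, y), (x + 1, y)}"

text \<open>
  \<open>domino_tower n k D\<close>: the set of dominoes \<open>D\<close> is the result of placing \<open>n - k\<close> further
  dominoes, one after the other, on a base of \<open>k\<close> consecutive dominoes. The polyomino
  itself is the set of cells \<open>\<Union>D\<close>; a polyomino has at most one such \<open>D\<close>, since a
  horizontal run of cells has at most one tiling by horizontal dominoes.
\<close>

inductive domino_tower :: "nat \<Rightarrow> nat \<Rightarrow> cell set set \<Rightarrow> bool" where
  base: "k \<ge> 1 \<Longrightarrow> domino_tower k k ((\<lambda>i. domino (x + 2 * int i) y) ` {..<k})"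
| place: "domino_tower n k D \<Longrightarrow> domino x y \<inter> \<Union>D = {} \<Longrightarrow>
    domino (x - 1) (y - 1) \<in> D \<or> domino x (y - 1) \<in> D \<or> domino (x + 1) (y - 1) \<in> D \<Longrightarrow>
    domino_tower (Suc n) k (insert (domino x y) D)"

definition consecutive :: "int set \<Rightarrow> bool" where
  "consecutive A \<longleftrightarrow> (\<exists>l r. A = {l..r})"

definition convex_polyomino :: "cell set \<Rightarrow> bool" where
  "convex_polyomino P \<longleftrightarrow>
    (\<forall>y. consecutive {x. (x, y) \<in> P}) \<and> (\<forall>x. consecutive {y. (x, y) \<in> P})"

definition row_length :: "cell set set \<Rightarrow> int \<Rightarrow> nat" where
  "row_length D y = card {d \<in> D. d \<subseteq> UNIV \<times> {y}}"

definition max_row_length :: "cell set set \<Rightarrow> nat" where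
  "max_row_length D = Max (row_length D ` snd ` \<Union>D)"

definition convex_towers :: "nat \<Rightarrow> nat \<Rightarrow> cell set set" where
  "convex_towers b n =
    {\<Union>D | D. (\<exists>k. domino_tower n k D) \<and> convex_polyomino (\<Union>D) \<and> max_row_length D = b}"

definition translation_equiv :: "(cell set \<times> cell set) set" where
  "translation_equiv = {(P, Q). \<exists>v. Q = (+) v ` P}"

definition num_convex_towers :: "nat \<Rightarrow> nat \<Rightarrow> nat" where
  "num_convex_towers b n = card (convex_towers b n // translation_equiv)"

end

theory Submission
  imports Defs
begin

text \<open>
  Read from the base upwards, each row of a convex tower can overhang the previous one by at most
  one cell on either side, and by convexity only on a side where the previous row already reaches
  the extreme column of the tower so far. So what lies above a row depends only on its length and
  on two bits, one per side. These states can be ranked so that every step either keeps the state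
  or lowers the rank. Hence the numbers of continuations, divided by \<open>2 ^ n\<close>, satisfy
  recurrences \<open>u n = a * u (n - m) + h n\<close> with \<open>h\<close> convergent, and \<open>a \<le> 1/2\<close>
  unless \<open>m = 1\<close> and exactly one bit is set; in that case there are exactly \<open>2 ^ n\<close>
  continuations. The limit is positive since such a state follows directly on a base of \<open>b\<close> dominoes.
\<close>

subsection \<open>Counting encoded towers\<close>

text \<open>
  A row of \<open>m'\<close> dominoes is put on a row of \<open>m\<close> dominoes, its left end shifted by \<open>d\<close> cells;
  \<open>p\<close> and \<open>q\<close> say that the left and the right end of the lower row are extreme for the tower so
  far. A tower is encoded by the length of its base and the list of the pairs \<open>(d, m')\<close>.
\<close>

definition admissible :: "bool \<Rightarrow> bool \<Rightarrow> nat \<Rightarrow> int \<Rightarrow> nat \<Rightarrow> bool" where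
  "admissible p q m d m' \<longleftrightarrow> 1 \<le> m' \<and> -1 \<le> d \<and> d + 2 * int m' \<le> 2 * int m + 1 \<and>
     (d = -1 \<longrightarrow> p) \<and> (d + 2 * int m' = 2 * int m + 1 \<longrightarrow> q)"

fun chain :: "bool \<Rightarrow> bool \<Rightarrow> nat \<Rightarrow> (int \<times> nat) list \<Rightarrow> bool" where
  "chain p q m [] \<longleftrightarrow> True"
| "chain p q m ((d, m') # zs) \<longleftrightarrow> admissible p q m d m' \<and>
     chain (p \<and> d \<le> 0) (q \<and> 2 * int m \<le> d + 2 * int m') m' zs"

section \<open>Continuations above a row and their recurrence\<close>

text \<open>Bounding all added rows by \<open>b\<close> leaves only finitely many states for them; a
  prescribed maximum is recovered later as a difference of two bounded counts. The given row of
  length \<open>m\<close> is not counted in \<open>n\<close>.\<close>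

definition continuations :: "nat \<Rightarrow> bool \<Rightarrow> bool \<Rightarrow> nat \<Rightarrow> nat \<Rightarrow> (int \<times> nat) list set" where
  "continuations b p q m n = {zs. chain p q m zs \<and> snd ` set zs \<subseteq> {..b} \<and> sum_list (map snd zs) = n}"

definition steps :: "nat \<Rightarrow> bool \<Rightarrow> bool \<Rightarrow> nat \<Rightarrow> (int \<times> nat) set" where
  "steps b p q m = {(d, m'). admissible p q m d m' \<and> m' \<le> b}"

lemma finite_steps: "finite (steps b p q m)"
  by (rule finite_subset[of _ "{-1..2 * int m + 1} \<times> {..b}"]) (auto simp: steps_def admissible_def)

lemma continuations_0: "continuations b p q m 0 = {[]}"
proof -
  have "zs = []" if "chain p q m zs" "sum_list (map snd zs) = 0" for zs
    using that by (cases zs) (auto simp: admissible_def)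
  then show ?thesis by (auto simp: continuations_def)
qed

text \<open>Split off the lowest added row; \<open>n > 0\<close> excludes the empty list. Without
  the filter \<open>snd z \<le> n\<close> the truncated subtraction \<open>n - m'\<close> would be 0
  for a row that is too long and admit a spurious list.\<close>

lemma continuations_rec:
  assumes "n > 0"
  shows "continuations b p q m n = (\<Union>(d, m') \<in> {z \<in> steps b p q m. snd z \<le> n}.
    (#) (d, m') ` continuations b (p \<and> d \<le> 0) (q \<and> 2 * int m \<le> d + 2 * int m') m' (n - m'))"
    (is "_ = ?R")
proof (rule set_eqI)
  fix zs
  show "zs \<in> continuations b p q m n \<longleftrightarrow> zs \<in> ?R"
  proof (cases zs)
    case Nil
    then show ?thesis using assms by (auto simp: continuations_def)
  next
    case (Cons z ws)
    obtain d m' where z: "z = (d, m')" by (cases z)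
    show ?thesis unfolding Cons z
      by (auto simp: continuations_def steps_def image_iff)
  qed
qed

lemma finite_continuations: "finite (continuations b p q m n)"
proof (induction n arbitrary: p q m rule: less_induct)
  case (less n)
  show ?case
  proof (cases "n = 0")
    case True
    then show ?thesis by (simp add: continuations_0)
  next
    case False
    have "finite (continuations b p' q' m' (n - m'))" if "(d, m') \<in> steps b p q m" "m' \<le> n" for p' q' d m'
      using that less[of "n - m'"] False by (auto simp: steps_def admissible_def)
    moreover have "finite {z \<in> steps b p q m. snd z \<le> n}"
      using finite_steps by simp
    ultimately show ?thesis using False
      by (subst continuations_rec) auto
  qed
qed

text \<open>Different first rows give disjoint sets. Moving the condition \<open>m' \<le> n\<close>
  into an \<open>if\<close> makes the index set independent of \<open>n\<close>, so the count is a
  fixed finite sum of shifted sequences.\<close>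

lemma card_continuations_rec:
  assumes "n > 0"
  shows "card (continuations b p q m n) = (\<Sum>(d, m') \<in> steps b p q m. if m' \<le> n then
    card (continuations b (p \<and> d \<le> 0) (q \<and> 2 * int m \<le> d + 2 * int m') m' (n - m')) else 0)"
proof -
  let ?S = "{z \<in> steps b p q m. snd z \<le> n}"
  let ?f = "\<lambda>z. card (continuations b (p \<and> fst z \<le> 0) (q \<and> 2 * int m \<le> fst z + 2 * int (snd z)) (snd z) (n - snd z))"
  have "card (continuations b p q m n) = (\<Sum>z \<in> ?S. card ((#) z ` continuations b (p \<and> fst z \<le> 0)
      (q \<and> 2 * int m \<le> fst z + 2 * int (snd z)) (snd z) (n - snd z)))"
    unfolding continuations_rec[OF assms] case_prod_unfold prod.collapse
    by (rule card_UN_disjoint) (auto simp: finite_steps finite_continuations)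
  also have "\<dots> = (\<Sum>z \<in> ?S. ?f z)"
    by (intro sum.cong refl card_image) (auto simp: inj_on_def)
  also have "\<dots> = (\<Sum>z \<in> steps b p q m. if snd z \<le> n then ?f z else 0)"
    by (simp add: sum.inter_filter finite_steps)
  finally show ?thesis by (simp add: case_prod_unfold)
qed

section \<open>Convergence of sequences given by affine recurrences\<close>

text \<open>Beyond a threshold \<open>K\<close> the indices are cut into blocks of length
  \<open>m\<close>; passing to the next block shrinks the bound for the excess over
  \<open>r / 2\<close> by the factor \<open>a\<close>.\<close>

lemma tendsto_zero_of_affine_recurrence:
  fixes v e :: "nat \<Rightarrow> real"
  assumes rec: "\<And>n. n \<ge> N \<Longrightarrow> v n = a * v (n - m) + e n"
    and m: "m \<ge> 1" and a: "0 \<le> a" "a < 1" and e: "e \<longlonglongrightarrow> 0"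
  shows "v \<longlonglongrightarrow> 0"
proof (rule LIMSEQ_I)
  fix r :: real assume r: "r > 0"
  \<comment> \<open>Chosen so that \<open>a * (r / 2) + c = r / 2\<close>: the level
    \<open>r / 2\<close> reproduces itself under one step with error \<open>c\<close>.\<close>
  define c where "c = r / 2 * (1 - a)"
  have c: "c > 0" using r a by (simp add: c_def)
  obtain N1 where N1: "\<And>n. n \<ge> N1 \<Longrightarrow> \<bar>e n\<bar> < c"
    using LIMSEQ_D[OF e c] by auto
  define K where "K = max N N1 + m"
  define B where "B = Max ((\<lambda>n. \<bar>v n\<bar>) ` {K..<K+m})"
  have B: "\<bar>v n\<bar> \<le> B" if "K \<le> n" "n < K + m" for n
    unfolding B_def using that by (intro Max_ge) auto
  have B0: "B \<ge> 0" using B[of K] m by (meson abs_ge_zero le_add1 less_add_same_cancel1 order.trans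
        less_le_trans zero_less_one order_refl)
  have bound: "\<bar>v n\<bar> \<le> r / 2 + a ^ j * B" if "K + j * m \<le> n" "n < K + Suc j * m" for j n
    using that
  proof (induction j arbitrary: n)
    case 0
    then show ?case using B[of n] r by simp
  next
    case (Suc j)
    have "\<bar>v (n - m)\<bar> \<le> r / 2 + a ^ j * B"
      using Suc.prems by (intro Suc.IH) auto
    then have "a * \<bar>v (n - m)\<bar> \<le> a * (r / 2 + a ^ j * B)"
      using a by (intro mult_left_mono) auto
    moreover have "\<bar>v n\<bar> \<le> a * \<bar>v (n - m)\<bar> + \<bar>e n\<bar>"
      using rec[of n] Suc.prems a abs_triangle_ineq[of "a * v (n - m)" "e n"]
      by (simp add: K_def abs_mult)
    moreover have "\<bar>e n\<bar> < c" using N1[of n] Suc.prems by (simp add: K_def)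
    ultimately show ?case by (simp add: c_def algebra_simps)
  qed
  have "(\<lambda>j. a ^ j * B) \<longlonglongrightarrow> 0"
    using a by (intro tendsto_mult_left_zero LIMSEQ_realpow_zero)
  from LIMSEQ_D[OF this, of "r / 2"] r obtain J where "\<And>j. j \<ge> J \<Longrightarrow> norm (a ^ j * B - 0) < r / 2"
    by auto
  then have J: "a ^ j * B < r / 2" if "j \<ge> J" for j using that by force
  show "\<exists>no. \<forall>n\<ge>no. norm (v n - 0) < r"
  proof (intro exI[of _ "K + J * m"] allI impI)
    fix n assume n: "n \<ge> K + J * m"
    define j where "j = (n - K) div m"
    have "j \<ge> J" unfolding j_def using n m by (intro less_eq_div_iff_mult_less_eq[THEN iffD2]) auto
    moreover have "j * m + (n - K) mod m = n - K" "(n - K) mod m < m"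
      using m by (auto simp: j_def)
    then have "K + j * m \<le> n" "n < K + Suc j * m"
      using n by auto
    ultimately show "norm (v n - 0) < r" using bound[of j n] J[of j] by simp
  qed
qed

text \<open>Subtracting the fixed point \<open>t = H / (1 - a)\<close> leaves an inhomogeneous term
  that tends to 0.\<close>

lemma convergent_affine_recurrence:
  fixes u h :: "nat \<Rightarrow> real"
  assumes rec: "\<And>n. n \<ge> N \<Longrightarrow> u n = a * u (n - m) + h n"
    and m: "m \<ge> 1" and a: "0 \<le> a" "a < 1" and h: "h \<longlonglongrightarrow> H"
  shows "convergent u"
proof -
  obtain t where t: "t = a * t + H"
  proof
    show "H / (1 - a) = a * (H / (1 - a)) + H" using a by (simp add: field_simps)
  qed
  have "(\<lambda>n. u n - t) \<longlonglongrightarrow> 0"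
  proof (rule tendsto_zero_of_affine_recurrence)
    show "u n - t = a * (u (n - m) - t) + (h n - H)" if "n \<ge> N" for n
      using rec[OF that] t by (simp add: right_diff_distrib)
    show "(\<lambda>n. h n - H) \<longlonglongrightarrow> 0" using h by (simp add: LIM_zero)
  qed (use assms in auto)
  then show ?thesis using LIM_zero_cancel convergentI by blast
qed

text \<open>Delaying the sequence by \<open>k\<close> divides the limit by \<open>2 ^ k\<close>; the
  default value 0 affects only the finitely many \<open>n < k\<close>. This treats the contribution
  of one placed row of \<open>k\<close> dominoes.\<close>

lemma convergent_shift_scaled:
  assumes "convergent (\<lambda>n. real (c n) / 2 ^ n)"
  shows "convergent (\<lambda>n. real (if k \<le> n then c (n - k) else 0) / 2 ^ n)"
proof -
  obtain t where "(\<lambda>n. real (c n) / 2 ^ n) \<longlonglongrightarrow> t"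
    using assms by (auto simp: convergent_def)
  then have "(\<lambda>n. real (c n) / 2 ^ n / 2 ^ k) \<longlonglongrightarrow> t / 2 ^ k"
    by (intro tendsto_divide tendsto_const) auto
  then have "(\<lambda>n. real (if k \<le> n + k then c (n + k - k) else 0) / 2 ^ (n + k)) \<longlonglongrightarrow> t / 2 ^ k"
    by (simp add: power_add)
  then show ?thesis
    by (intro convergentI[of _ "t / 2 ^ k"]) (rule LIMSEQ_offset)
qed

text \<open>A single-domino row whose tower may still overhang on exactly one side can only be followed
  by rows of the same kind, with two positions each; this is the source of the factor 2.\<close>

lemma steps_drifting:
  assumes "p \<noteq> q" "b \<ge> 1"
  shows "steps b p q (Suc 0) = {(0, Suc 0), (if p then -1 else 1, Suc 0)}"
  using assms by (auto simp: steps_def admissible_def)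

lemma card_continuations_drifting:
  assumes "p \<noteq> q" "b \<ge> 1"
  shows "card (continuations b p q (Suc 0) n) = 2 ^ n"
proof (induction n)
  case 0
  then show ?case by (simp add: continuations_0)
next
  case (Suc n)
  then show ?case using assms
    by (subst card_continuations_rec) (auto simp: steps_drifting)
qed

section \<open>Convergence of the scaled continuation counts\<close>

text \<open>A step that keeps the state has \<open>d = 0\<close>, except that with exactly one bit
  set a shift by one cell towards that side is possible as well. So there is at most one such step,
  or at most two with \<open>m \<ge> 2\<close>, and \<open>2 ^ m\<close> exceeds this
  number.\<close>

lemma self_steps:
  assumes "\<not> (p \<noteq> q \<and> m = 1)" "m \<ge> 1"
  shows "real (card {(d, m') \<in> steps b p q m. m' = m \<and> (p \<and> d \<le> 0) = p \<and>
    (q \<and> 2 * int m \<le> d + 2 * int m') = q}) / 2 ^ m < 1" (is "real (card ?S) / _ < 1")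
proof -
  have sub: "?S \<subseteq> (if p = q then {(0, m)} else {(0, m), (if p then -1 else 1, m)})"
    by (auto simp: steps_def admissible_def)
  then have "card ?S \<le> card (if p = q then {(0, m)} else {(0::int, m), (if p then -1 else 1, m)})"
    by (intro card_mono) auto
  also have "\<dots> = (if p = q then 1 else 2)" by simp
  also have "\<dots> < 2 ^ m"
  proof (cases "m = 1")
    case True
    then show ?thesis using assms by simp
  next
    case False
    then have "(2::nat) ^ 2 \<le> 2 ^ m" using assms by (intro power_increasing) auto
    then show ?thesis by (simp split: if_split)
  qed
  finally show ?thesis
    by (simp add: divide_less_eq)
qed

text \<open>Bits are never regained, so their number is the leading digit, with weight
  \<open>b + 1\<close> exceeding every length. While both bits survive, each row covers the one
  below and lengths can only grow, hence \<open>b - m\<close>; with at most one bit and no further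
  loss, lengths can only shrink, hence \<open>m\<close>.\<close>

definition rank :: "nat \<Rightarrow> bool \<Rightarrow> bool \<Rightarrow> nat \<Rightarrow> nat" where
  "rank b p q m = (of_bool p + of_bool q) * (b + 1) + (if p \<and> q then b - m else m)"

lemma rank_decreases:
  assumes "(d, m') \<in> steps b p q m" "m \<le> b"
    and "\<not> (m' = m \<and> (p \<and> d \<le> 0) = p \<and> (q \<and> 2 * int m \<le> d + 2 * int m') = q)"
  shows "rank b (p \<and> d \<le> 0) (q \<and> 2 * int m \<le> d + 2 * int m') m' < rank b p q m"
  using assms by (cases p; cases q) (auto simp: rank_def steps_def admissible_def)

text \<open>Induction on the rank. The steps in \<open>S\<close> return to the same state and
  combine into the term \<open>a * u (n - m)\<close>; those in \<open>R\<close> lead to smaller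
  rank, so by induction their total \<open>h\<close> converges. In the drifting case the scaled
  count is constantly 1.\<close>

lemma convergent_continuations:
  assumes "1 \<le> m" "m \<le> b"
  shows "convergent (\<lambda>n. real (card (continuations b p q m n)) / 2 ^ n)"
  using assms
proof (induction "rank b p q m" arbitrary: p q m rule: less_induct)
  case less
  show ?case
  proof (cases "p \<noteq> q \<and> m = 1")
    case True
    then show ?thesis using less.prems by (auto simp: card_continuations_drifting convergent_const)
  next
    case False
    define self where "self = (\<lambda>(d, m'). m' = m \<and> (p \<and> d \<le> 0) = p \<and> (q \<and> 2 * int m \<le> d + 2 * int m') = q)"
    define S where "S = {z \<in> steps b p q m. self z}"
    define R where "R = {z \<in> steps b p q m. \<not> self z}"
    define G where "G = (\<lambda>(d, m') n. card (continuations b (p \<and> d \<le> 0) (q \<and> 2 * int m \<le> d + 2 * int m') m' n))"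
    define h where "h n = (\<Sum>z\<in>R. real (if snd z \<le> n then G z (n - snd z) else 0) / 2 ^ n)" for n
    define a where "a = real (card S) / 2 ^ m"
    have fin: "finite S" "finite R" by (simp_all add: S_def R_def finite_steps)
    have "S = {(d, m') \<in> steps b p q m. m' = m \<and> (p \<and> d \<le> 0) = p \<and>
        (q \<and> 2 * int m \<le> d + 2 * int m') = q}"
      by (auto simp: S_def self_def)
    then have a: "0 \<le> a" "a < 1"
      using self_steps[OF False less.prems(1), of b] by (simp_all add: a_def)
    have "convergent h" unfolding h_def
    proof (intro convergent_sum convergent_shift_scaled)
      fix z assume z: "z \<in> R"
      obtain d m' where zz: "z = (d, m')" by (cases z)
      have "convergent (\<lambda>n. real (card (continuations b (p \<and> d \<le> 0)
          (q \<and> 2 * int m \<le> d + 2 * int m') m' n)) / 2 ^ n)"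
        using z less.prems
        by (intro less.hyps rank_decreases) (auto simp: R_def self_def zz steps_def admissible_def)
      then show "convergent (\<lambda>n. real (G z n) / 2 ^ n)" by (simp add: G_def zz)
    qed
    then obtain H where H: "h \<longlonglongrightarrow> H" by (auto simp: convergent_def)
    show ?thesis
    proof (rule convergent_affine_recurrence[OF _ less.prems(1) a H])
      fix n assume n: "n \<ge> m"
      have "real (card (continuations b p q m n)) =
          (\<Sum>z\<in>steps b p q m. real (if snd z \<le> n then G z (n - snd z) else 0))"
        using n less.prems unfolding G_def case_prod_unfold
        by (subst card_continuations_rec) (auto simp: case_prod_unfold)
      also have "steps b p q m = S \<union> R" by (auto simp: S_def R_def)
      also have "(\<Sum>z\<in>S \<union> R. real (if snd z \<le> n then G z (n - snd z) else 0)) =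
          (\<Sum>z\<in>S. real (if snd z \<le> n then G z (n - snd z) else 0)) +
          (\<Sum>z\<in>R. real (if snd z \<le> n then G z (n - snd z) else 0))"
        by (intro sum.union_disjoint fin) (auto simp: S_def R_def)
      also have "(\<Sum>z\<in>S. real (if snd z \<le> n then G z (n - snd z) else 0)) =
          (\<Sum>z\<in>S. real (card (continuations b p q m (n - m))))"
      proof (intro sum.cong refl)
        fix z assume "z \<in> S"
        then have "snd z = m" "G z = (\<lambda>n. card (continuations b p q m n))"
          by (auto simp: S_def self_def G_def split: prod.splits)
        then show "real (if snd z \<le> n then G z (n - snd z) else 0) = real (card (continuations b p q m (n - m)))"
          using n by simp
      qed
      finally have eq: "real (card (continuations b p q m n)) = card S * real (card (continuations b p q m (n - m))) +
          (\<Sum>z\<in>R. real (if snd z \<le> n then G z (n - snd z) else 0))" by simp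
      \<comment> \<open>Dividing by this product turns the factor \<open>card S\<close> into
        \<open>a\<close> and rescales the count at \<open>n - m\<close> correctly.\<close>
      have "(2::real) ^ n = 2 ^ m * 2 ^ (n - m)" using n by (simp flip: power_add)
      then show "real (card (continuations b p q m n)) / 2 ^ n =
          a * (real (card (continuations b p q m (n - m))) / 2 ^ (n - m)) + h n"
        unfolding eq h_def a_def sum_divide_distrib[symmetric] by (simp add: add_divide_distrib)
    qed
  qed
qed

section \<open>Codes of whole towers and their asymptotics\<close>

text \<open>Both bits start as \<open>True\<close>, since the two ends of the base are extreme as
  long as nothing lies above it.\<close>

definition bounded_codes :: "nat \<Rightarrow> nat \<Rightarrow> (nat \<times> (int \<times> nat) list) set" where
  "bounded_codes b n = {(k, zs). 1 \<le> k \<and> k \<le> b \<and> chain True True k zs \<and> snd ` set zs \<subseteq> {..b} \<and>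
     k + sum_list (map snd zs) = n}"

definition codes :: "nat \<Rightarrow> nat \<Rightarrow> (nat \<times> (int \<times> nat) list) set" where
  "codes b n = {(k, zs). 1 \<le> k \<and> chain True True k zs \<and> Max (insert k (snd ` set zs)) = b \<and>
     k + sum_list (map snd zs) = n}"

lemma bounded_codes_eq:
  "bounded_codes b n = (SIGMA k:{k\<in>{1..b}. k \<le> n}. continuations b True True k (n - k))"
  by (auto simp: bounded_codes_def continuations_def)

lemma finite_bounded_codes: "finite (bounded_codes b n)"
  unfolding bounded_codes_eq by (intro finite_SigmaI) (auto simp: finite_continuations)

lemma convergent_bounded_codes: "convergent (\<lambda>n. real (card (bounded_codes b n)) / 2 ^ n)"
proof -
  have "card (bounded_codes b n) =
      (\<Sum>k\<in>{1..b}. if k \<le> n then card (continuations b True True k (n - k)) else 0)" for n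
    unfolding bounded_codes_eq
    by (subst card_SigmaI, simp, simp add: finite_continuations, rule sum.inter_filter) simp
  then have "(\<lambda>n. real (card (bounded_codes b n)) / 2 ^ n) =
      (\<lambda>n. \<Sum>k\<in>{1..b}. real (if k \<le> n then card (continuations b True True k (n - k)) else 0) / 2 ^ n)"
    by (simp add: sum_divide_distrib)
  then show ?thesis
    by (simp only:) (intro convergent_sum convergent_shift_scaled convergent_continuations; simp)
qed

text \<open>The exact maximum becomes a difference of bounded counts, each of which converges after
  scaling. With \<open>b \<ge> 1\<close> the truncated \<open>b - 1\<close> is the true
  predecessor.\<close>

lemma codes_eq:
  assumes "b \<ge> 1"
  shows "codes b n = bounded_codes b n - bounded_codes (b - 1) n"
proof (rule set_eqI)
  fix c :: "nat \<times> (int \<times> nat) list"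
  obtain k zs where c: "c = (k, zs)" by (cases c)
  have "Max (insert k (snd ` set zs)) = b \<longleftrightarrow>
      (insert k (snd ` set zs) \<subseteq> {..b} \<and> \<not> insert k (snd ` set zs) \<subseteq> {..b-1})"
  proof -
    let ?A = "insert k (snd ` set zs)"
    have "a \<in> {..b-1} \<longleftrightarrow> a \<in> {..b} \<and> a \<noteq> b" for a using assms by auto
    then have "?A \<subseteq> {..b} \<and> \<not> ?A \<subseteq> {..b-1} \<longleftrightarrow> ?A \<subseteq> {..b} \<and> b \<in> ?A" by blast
    then show ?thesis by (subst Max_eq_iff) blast+
  qed
  then show "c \<in> codes b n \<longleftrightarrow> c \<in> bounded_codes b n - bounded_codes (b - 1) n"
    unfolding c codes_def bounded_codes_def by auto
qed

text \<open>A single domino placed flush left on a base of \<open>b > 1\<close> dominoes keeps the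
  left bit and loses the right one. This is the drifting state, which the remaining
  \<open>n - (b + 1)\<close> dominoes continue in \<open>2 ^ (n - (b + 1))\<close> ways.\<close>

lemma codes_lower_bound:
  assumes "b > 1" "n \<ge> b + 1"
  shows "2 ^ (n - (b + 1)) \<le> card (codes b n)"
proof -
  have "card ((\<lambda>zs. (b, (0, 1) # zs)) ` continuations 1 True False 1 (n - (b + 1))) =
      card (continuations 1 True False 1 (n - (b + 1)))"
    by (intro card_image) (auto simp: inj_on_def)
  also have "\<dots> = 2 ^ (n - (b + 1))"
    using card_continuations_drifting[of True False 1] by simp
  finally have "card ((\<lambda>zs. (b, (0, 1) # zs)) ` continuations 1 True False 1 (n - (b + 1))) = 2 ^ (n - (b + 1))" .
  moreover have "(\<lambda>zs. (b, (0, 1) # zs)) ` continuations 1 True False 1 (n - (b + 1)) \<subseteq> codes b n"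
  proof (intro subsetI; elim imageE)
    fix c zs assume zs: "zs \<in> continuations 1 True False 1 (n - (b + 1))" and c: "c = (b, (0, 1) # zs)"
    have "Max (insert b (snd ` set ((0, 1) # zs))) = b"
      using zs assms by (intro Max_eqI) (auto simp: continuations_def)
    then show "c \<in> codes b n"
      using zs assms unfolding c codes_def by (simp add: continuations_def admissible_def)
  qed
  moreover have "finite (codes b n)"
    using assms by (simp add: codes_eq finite_bounded_codes)
  ultimately show ?thesis by (metis card_mono)
qed

lemma codes_asymptotics:
  assumes "b > 1"
  shows "\<exists>\<theta>::real. \<theta> \<noteq> 0 \<and> (\<lambda>n. real (card (codes b n))) \<sim>[at_top] (\<lambda>n. \<theta> * 2 ^ n)"
proof -
  have "card (codes b n) = card (bounded_codes b n) - card (bounded_codes (b - 1) n)"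
    "card (bounded_codes (b - 1) n) \<le> card (bounded_codes b n)" for n
  proof -
    have "bounded_codes (b - 1) n \<subseteq> bounded_codes b n"
      by (fastforce simp: bounded_codes_def)
    then show "card (codes b n) = card (bounded_codes b n) - card (bounded_codes (b - 1) n)"
      "card (bounded_codes (b - 1) n) \<le> card (bounded_codes b n)"
      using assms by (auto simp: codes_eq finite_bounded_codes card_Diff_subset intro!: card_mono)
  qed
  then have "(\<lambda>n. real (card (codes b n)) / 2 ^ n) = (\<lambda>n. real (card (bounded_codes b n)) / 2 ^ n -
      real (card (bounded_codes (b - 1) n)) / 2 ^ n)"
    by (simp add: of_nat_diff diff_divide_distrib)
  then have "convergent (\<lambda>n. real (card (codes b n)) / 2 ^ n)"
    by (simp only:) (intro convergent_diff convergent_bounded_codes)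
  then obtain t where t: "(\<lambda>n. real (card (codes b n)) / 2 ^ n) \<longlonglongrightarrow> t"
    by (auto simp: convergent_def)
  \<comment> \<open>Convergence alone would allow the limit 0; the lower bound on
    \<open>codes\<close> excludes it.\<close>
  have "1 / 2 ^ (b + 1) \<le> t"
  proof (rule LIMSEQ_le_const[OF t], intro exI allI impI)
    fix n assume n: "b + 1 \<le> n"
    have "real (2 ^ (n - (b + 1))) \<le> real (card (codes b n))"
      using codes_lower_bound[OF assms n] by (rule of_nat_mono)
    moreover have "(2::real) ^ n = 2 ^ (b + 1) * 2 ^ (n - (b + 1))"
      using n by (metis le_add_diff_inverse power_add)
    ultimately show "1 / 2 ^ (b + 1) \<le> real (card (codes b n)) / 2 ^ n"
      by (simp add: field_simps)
  qed
  then have "t > 0" by (meson less_le_trans zero_less_divide_1_iff zero_less_numeral zero_less_power)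
  moreover have "(\<lambda>n. real (card (codes b n))) \<sim>[at_top] (\<lambda>n. t * 2 ^ n)"
  proof (rule asymp_equivI')
    have "(\<lambda>n. real (card (codes b n)) / 2 ^ n / t) \<longlonglongrightarrow> t / t"
      using \<open>t > 0\<close> by (intro tendsto_divide t tendsto_const) auto
    then show "(\<lambda>n. real (card (codes b n)) / (t * 2 ^ n)) \<longlonglongrightarrow> 1"
      using \<open>t > 0\<close> by (simp add: field_simps)
  qed
  ultimately show ?thesis by (intro exI[of _ t]) auto
qed

subsection \<open>Encoded towers as polyominoes\<close>

definition row :: "int \<Rightarrow> int \<Rightarrow> nat \<Rightarrow> cell set set" where
  "row l y m = (\<lambda>i. domino (l + 2 * int i) y) ` {..<m}"

text \<open>Decodes \<open>(m, zs)\<close> into dominoes with lower left cell \<open>(l, y)\<close>;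
  each shift \<open>d\<close> is relative to the row directly below.\<close>

fun stack :: "int \<Rightarrow> int \<Rightarrow> nat \<Rightarrow> (int \<times> nat) list \<Rightarrow> cell set set" where
  "stack l y m [] = row l y m"
| "stack l y m ((d, m') # zs) = row l y m \<union> stack (l + d) (y + 1) m' zs"

lemma domino_eq_iff: "domino x y = domino x' y' \<longleftrightarrow> x = x' \<and> y = y'"
  by (auto simp: domino_def doubleton_eq_iff)

lemma domino_in_row: "domino x z \<in> row l y m \<longleftrightarrow> z = y \<and> x \<in> (\<lambda>i. l + 2 * int i) ` {..<m}"
  by (auto simp: row_def domino_eq_iff)

lemma cell_in_row: "(x, z) \<in> \<Union>(row l y m) \<longleftrightarrow> z = y \<and> l \<le> x \<and> x < l + 2 * int m"
proof
  assume "z = y \<and> l \<le> x \<and> x < l + 2 * int m"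
  then have "(x, z) \<in> domino (l + 2 * int (nat ((x - l) div 2))) y" "nat ((x - l) div 2) < m"
    by (auto simp: domino_def)
  then show "(x, z) \<in> \<Union>(row l y m)" unfolding row_def by blast
qed (auto simp: row_def domino_def)

lemma cell_in_stack_Cons:
  "(x, z) \<in> \<Union>(stack l y m ((d, m') # zs)) \<longleftrightarrow>
    (z = y \<and> l \<le> x \<and> x < l + 2 * int m) \<or> (x, z) \<in> \<Union>(stack (l + d) (y + 1) m' zs)"
  unfolding stack.simps Union_Un_distrib Un_iff cell_in_row ..

lemma cell_in_stack_height: "(x, z) \<in> \<Union>(stack l y m zs) \<Longrightarrow> y \<le> z"
proof (induction l y m zs rule: stack.induct)
  case (1 l y m)
  then show ?case unfolding stack.simps cell_in_row by simp
next
  case (2 l y m d m' zs)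
  then show ?case unfolding cell_in_stack_Cons by force
qed

lemma cell_in_stack_bottom: "(x, y) \<in> \<Union>(stack l y m zs) \<longleftrightarrow> l \<le> x \<and> x < l + 2 * int m"
proof (cases zs)
  case Nil
  then show ?thesis unfolding Nil stack.simps cell_in_row by simp
next
  case (Cons z ws)
  obtain d m' where z: "z = (d, m')" by (cases z)
  show ?thesis
    unfolding Cons z cell_in_stack_Cons
    using cell_in_stack_height[of x y "l + d" "y + 1" m' ws] by linarith
qed

text \<open>Describes the stack without its lowest row through the cells of the whole stack only, so
  that the code can be read off the polyomino row by row.\<close>

lemma cell_in_upper_stack:
  "v \<in> \<Union>(stack (l + fst z) (y + 1) (snd z) zs) \<longleftrightarrow> v \<in> \<Union>(stack l y m (z # zs)) \<and> y < snd v"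
proof -
  obtain x h d m' where v: "v = (x, h)" and z: "z = (d, m')" by (metis surj_pair)
  show ?thesis
    unfolding v z fst_conv snd_conv cell_in_stack_Cons
    using cell_in_stack_height[of x h "l + d" "y + 1" m' zs] by force
qed

lemma stack_not_single_row:
  assumes "\<Union>(stack l y m (z # zs)) = \<Union>(row l y m')"
  shows "snd z < 1"
proof (rule ccontr)
  assume "\<not> snd z < 1"
  then have "(l + fst z, y + 1) \<in> \<Union>(stack (l + fst z) (y + 1) (snd z) zs)"
    unfolding cell_in_stack_bottom by simp
  then have "(l + fst z, y + 1) \<in> \<Union>(row l y m')"
    unfolding cell_in_upper_stack[where m = m] assms by simp
  then show False unfolding cell_in_row by simp
qed

lemma chain_pos: "chain p q m zs \<Longrightarrow> z \<in> set zs \<Longrightarrow> 1 \<le> snd z"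
  by (induction p q m zs rule: chain.induct) (auto simp: admissible_def)

lemma stack_bottom_eq:
  assumes eq: "\<Union>(stack l y m zs) = \<Union>(stack l' y' m' zs')" and m: "1 \<le> m" "1 \<le> m'"
  shows "l = l' \<and> y = y' \<and> m = m'"
proof -
  have "(l, y) \<in> \<Union>(stack l y m zs)" "(l', y') \<in> \<Union>(stack l' y' m' zs')"
    unfolding cell_in_stack_bottom using m by auto
  then have "y' \<le> y" "y \<le> y'" by (metis cell_in_stack_height eq)+
  then have y: "y = y'" by simp
  have "l \<le> x \<and> x < l + 2 * int m \<longleftrightarrow> l' \<le> x \<and> x < l' + 2 * int m'" for x
    by (metis cell_in_stack_bottom eq y)
  \<comment> \<open>Testing the equivalence at the end cells of both intervals forces equal
    ends.\<close>
  from this[of l] this[of l'] this[of "l + 2 * int m - 1"] this[of "l' + 2 * int m' - 1"]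
  show ?thesis using y m by auto
qed

text \<open>Peel off the lowest row repeatedly. The lengths are positive because an empty row would
  leave no trace among the cells.\<close>

lemma stack_inj:
  assumes "\<Union>(stack l y m zs) = \<Union>(stack l' y' m' zs')" "1 \<le> m" "1 \<le> m'"
    and "\<And>z. z \<in> set zs \<Longrightarrow> 1 \<le> snd z" "\<And>z. z \<in> set zs' \<Longrightarrow> 1 \<le> snd z"
  shows "l = l' \<and> y = y' \<and> m = m' \<and> zs = zs'"
  using assms
proof (induction zs arbitrary: l y m l' y' m' zs')
  case Nil
  have eq: "l' = l" "y' = y" "m' = m" using stack_bottom_eq[OF Nil(1-3)] by auto
  show ?case
  proof (cases zs')
    case (Cons z ws)
    have "snd z < 1"
      using Nil(1) unfolding eq Cons stack.simps(1) by (intro stack_not_single_row) (rule sym)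
    then show ?thesis using Nil(5)[of z] Cons by simp
  qed (use eq in simp)
next
  case (Cons z ws)
  have eq: "l' = l" "y' = y" "m' = m" using stack_bottom_eq[OF Cons.prems(1-3)] by auto
  show ?case
  proof (cases zs')
    case Nil
    have "snd z < 1"
      using Cons.prems(1) unfolding eq Nil stack.simps(1) by (rule stack_not_single_row)
    then show ?thesis using Cons.prems(4)[of z] by simp
  next
    case zs': (Cons z' ws')
    have "\<Union>(stack (l + fst z) (y + 1) (snd z) ws) = \<Union>(stack (l + fst z') (y + 1) (snd z') ws')"
      unfolding set_eq_iff cell_in_upper_stack[where m = m]
      using Cons.prems(1) unfolding eq zs' by simp
    then have "l + fst z = l + fst z' \<and> y + 1 = y + 1 \<and> snd z = snd z' \<and> ws = ws'"
      by (rule Cons.IH) (use Cons.prems zs' in auto)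
    then show ?thesis using eq zs' by (auto simp: prod_eq_iff)
  qed
qed

lemma mem_translate_iff: "v \<in> (+) w ` S \<longleftrightarrow> v - w \<in> S" for v w :: "'a::ab_group_add"
proof
  assume "v - w \<in> S"
  moreover have "v = w + (v - w)" by simp
  ultimately show "v \<in> (+) w ` S" by (rule rev_image_eqI)
qed auto

lemma translate_stack: "(+) (a, c) ` \<Union>(stack l y m zs) = \<Union>(stack (l + a) (y + c) m zs)"
proof -
  have row: "(+) (a, c) ` \<Union>(row l y m) = \<Union>(row (l + a) (y + c) m)" for l y m
  proof (rule set_eqI)
    fix v :: cell
    obtain x z where v: "v = (x, z)" by (cases v)
    show "v \<in> (+) (a, c) ` \<Union>(row l y m) \<longleftrightarrow> v \<in> \<Union>(row (l + a) (y + c) m)"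
      unfolding v mem_translate_iff diff_Pair cell_in_row by linarith
  qed
  show ?thesis
  proof (induction l y m zs rule: stack.induct)
    case (2 l y m d m' zs)
    have "l + d + a = l + a + d" "y + 1 + c = y + c + 1" by simp_all
    then show ?case by (simp only: stack.simps Union_Un_distrib image_Un row 2)
  qed (simp only: stack.simps row)
qed

section \<open>Admissible chains build convex domino towers\<close>

text \<open>Finiteness and order convexity are easier to check for the columns of a growing
  polyomino than explicit end points. The empty set is included, as \<open>{1..0}\<close>.\<close>

lemma consecutive_iff:
  "consecutive A \<longleftrightarrow> finite A \<and> (\<forall>a\<in>A. \<forall>c\<in>A. \<forall>b. a \<le> b \<and> b \<le> c \<longrightarrow> b \<in> A)"
proof
  assume A: "finite A \<and> (\<forall>a\<in>A. \<forall>c\<in>A. \<forall>b. a \<le> b \<and> b \<le> c \<longrightarrow> b \<in> A)"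
  show "consecutive A"
  proof (cases "A = {}")
    case True
    then have "A = {1..0}" by simp
    then show ?thesis unfolding consecutive_def by blast
  next
    case False
    have fin: "finite A" using A by blast
    then have "Min A \<in> A" "Max A \<in> A" using False by simp_all
    then have "{Min A..Max A} \<subseteq> A" using A by (meson atLeastAtMost_iff subsetI)
    moreover have "A \<subseteq> {Min A..Max A}" using fin by (intro subsetI) simp
    ultimately have "A = {Min A..Max A}" by (rule subset_antisym[rotated])
    then show ?thesis unfolding consecutive_def by blast
  qed
next
  assume "consecutive A"
  then obtain l r where "A = {l..r}" unfolding consecutive_def by blast
  then show "finite A \<and> (\<forall>a\<in>A. \<forall>c\<in>A. \<forall>b. a \<le> b \<and> b \<le> c \<longrightarrow> b \<in> A)" by simp
qed

text \<open>Invariant of the polyomino built so far, whose top row starts at \<open>(l, y)\<close>.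
  A bit only implies that its end is extreme: in this direction it has to be shown that allowed
  overhangs are safe, not that all safe ones are allowed.\<close>

definition partial_tower :: "bool \<Rightarrow> bool \<Rightarrow> int \<Rightarrow> int \<Rightarrow> nat \<Rightarrow> cell set \<Rightarrow> bool" where
  "partial_tower p q l y m P \<longleftrightarrow> convex_polyomino P \<and> (\<forall>x z. (x, z) \<in> P \<longrightarrow> z \<le> y) \<and>
     (\<forall>x. (x, y) \<in> P \<longleftrightarrow> l \<le> x \<and> x < l + 2 * int m) \<and>
     (p \<longrightarrow> (\<forall>x z. (x, z) \<in> P \<longrightarrow> l \<le> x)) \<and> (q \<longrightarrow> (\<forall>x z. (x, z) \<in> P \<longrightarrow> x < l + 2 * int m))"

lemma partial_tower_step:
  assumes P: "partial_tower p q l y m P" and s: "admissible p q m d m'"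
  shows "partial_tower (p \<and> d \<le> 0) (q \<and> 2 * int m \<le> d + 2 * int m') (l + d) (y + 1) m'
    (P \<union> \<Union>(row (l + d) (y + 1) m'))"
proof -
  define Q where "Q = P \<union> \<Union>(row (l + d) (y + 1) m')"
  have cell: "(x, z) \<in> Q \<longleftrightarrow> (x, z) \<in> P \<or> (z = y + 1 \<and> l + d \<le> x \<and> x < l + d + 2 * int m')" for x z
    unfolding Q_def Un_iff cell_in_row ..
  have height: "(x, z) \<in> P \<Longrightarrow> z \<le> y" for x z using P by (auto simp: partial_tower_def)
  have top: "(x, y) \<in> P \<longleftrightarrow> l \<le> x \<and> x < l + 2 * int m" for x
    using P by (auto simp: partial_tower_def)
  have cons: "consecutive {x. (x, z) \<in> P}" "consecutive {z. (x, z) \<in> P}" for x z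
    using P by (auto simp: partial_tower_def convex_polyomino_def)
  have between: "(x, v) \<in> P" if "(x, u) \<in> P" "(x, w) \<in> P" "u \<le> v" "v \<le> w" for x u v w
    using cons(2)[of x] that unfolding consecutive_iff by blast
  have rows: "consecutive {x. (x, z) \<in> Q}" for z
  proof (cases "z = y + 1")
    case True
    then have "{x. (x, z) \<in> Q} = {l + d..l + d + 2 * int m' - 1}"
      unfolding cell using height[of _ z] by auto
    then show ?thesis unfolding consecutive_def by blast
  next
    case False
    then have "{x. (x, z) \<in> Q} = {x. (x, z) \<in> P}" unfolding cell by auto
    then show ?thesis using cons by simp
  qed
  \<comment> \<open>The reason why columns stay gapless: a column of \<open>P\<close> below the new
    row already meets the old top row. On a side whose bit is set all of \<open>P\<close> ends with
    that row; on the other side the new row does not overhang.\<close>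
  have new: "(x, y) \<in> P" if "(x, z) \<in> P" "l + d \<le> x" "x < l + d + 2 * int m'" for x z
  proof -
    have "l \<le> x"
    proof (cases p)
      case True
      then show ?thesis using P that(1) by (auto simp: partial_tower_def)
    next
      case False
      then show ?thesis using s that by (auto simp: admissible_def)
    qed
    moreover have "x < l + 2 * int m"
    proof (cases q)
      case True
      then show ?thesis using P that(1) by (auto simp: partial_tower_def)
    next
      case False
      then show ?thesis using s that by (auto simp: admissible_def)
    qed
    ultimately show ?thesis by (simp add: top)
  qed
  have columns: "consecutive {z. (x, z) \<in> Q}" for x
    unfolding consecutive_iff
  proof (intro conjI ballI allI impI)
    have "{z. (x, z) \<in> Q} \<subseteq> insert (y + 1) {z. (x, z) \<in> P}" unfolding cell by auto
    then show "finite {z. (x, z) \<in> Q}"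
      using cons(2)[of x] by (auto simp: consecutive_iff intro: finite_subset)
    fix u v w assume u: "u \<in> {z. (x, z) \<in> Q}" and w: "w \<in> {z. (x, z) \<in> Q}" and v: "u \<le> v \<and> v \<le> w"
    show "v \<in> {z. (x, z) \<in> Q}"
    proof (cases "v = u \<or> v = w")
      case True
      then show ?thesis using u w by blast
    next
      case False
      then have uvw: "u < v" "v < w" using v by simp_all
      have "(x, w) \<in> P \<or> w = y + 1 \<and> l + d \<le> x \<and> x < l + d + 2 * int m'"
        using w by (simp add: cell)
      then have "w \<le> y + 1" using height[of x w] by linarith
      then have Pu: "(x, u) \<in> P" using u uvw by (simp add: cell)
      show ?thesis
      proof (cases "(x, w) \<in> P")
        case True
        then show ?thesis using between[OF Pu, of w v] v by (simp add: cell)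
      next
        case False
        then have "(x, y) \<in> P" "w = y + 1" using w new[OF Pu] by (simp_all add: cell)
        then show ?thesis using between[OF Pu, of y v] uvw by (simp add: cell)
      qed
    qed
  qed
  have "convex_polyomino Q" using rows columns by (simp add: convex_polyomino_def)
  moreover have "l + d \<le> x" if "p \<and> d \<le> 0" "(x, z) \<in> Q" for x z
    using that P unfolding cell partial_tower_def by fastforce
  moreover have "x < l + d + 2 * int m'" if "q \<and> 2 * int m \<le> d + 2 * int m'" "(x, z) \<in> Q" for x z
    using that P unfolding cell partial_tower_def by fastforce
  moreover have "z \<le> y + 1" if "(x, z) \<in> Q" for x z
    using that height[of x z] unfolding cell by auto
  moreover have "(x, y + 1) \<in> Q \<longleftrightarrow> l + d \<le> x \<and> x < l + d + 2 * int m'" for x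
    using height[of x "y + 1"] unfolding cell by auto
  ultimately show ?thesis unfolding partial_tower_def Q_def[symmetric] by blast
qed

text \<open>The new row is placed domino by domino from left to right, and \<open>j\<close> counts
  those already placed.\<close>

lemma domino_tower_add_row:
  assumes D: "domino_tower n k D" and row: "row l y m \<subseteq> D"
    and height: "\<And>x z. (x, z) \<in> \<Union>D \<Longrightarrow> z \<le> y"
    and s: "admissible p q m d m'" and m: "1 \<le> m" and j: "j \<le> m'"
  shows "domino_tower (n + j) k (D \<union> row (l + d) (y + 1) j)"
  using j
proof (induction j)
  case 0
  then show ?case using D by (simp add: row_def)
next
  case (Suc j)
  let ?x = "l + d + 2 * int j" and ?E = "D \<union> row (l + d) (y + 1) j"
  have mem: "domino x y \<in> ?E" if "x = l + 2 * i" "0 \<le> i" "i < int m" for x i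
  proof -
    have "domino x y \<in> row l y m"
      unfolding row_def by (rule image_eqI[of _ _ "nat i"]) (use that in auto)
    then show ?thesis using row by blast
  qed
  \<comment> \<open>For even \<open>d\<close> the new domino lies exactly on one below. For odd
    \<open>d\<close> it is supported by the domino starting one cell further left, unless that would
    lie beyond the left end of the row, in which case the first domino of the row supports
    it.\<close>
  have "domino (?x - 1) y \<in> ?E \<or> domino ?x y \<in> ?E \<or> domino (?x + 1) y \<in> ?E"
  proof (cases "even d")
    case True
    then obtain i where "d = 2 * i" by blast
    then have "domino ?x y \<in> ?E"
      using s Suc.prems by (intro mem[of _ "i + int j"]) (auto simp: admissible_def)
    then show ?thesis by blast
  next
    case False
    then obtain i where i: "d = 2 * i + 1" by (rule oddE)
    show ?thesis
    proof (cases "i + int j < 0")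
      case True
      then have "domino (?x + 1) y \<in> ?E"
        using s Suc.prems i m by (intro mem[of _ 0]) (auto simp: admissible_def)
      then show ?thesis by blast
    next
      case False
      then have "domino (?x - 1) y \<in> ?E"
        using s Suc.prems i by (intro mem[of _ "i + int j"]) (auto simp: admissible_def)
      then show ?thesis by blast
    qed
  qed
  moreover have "domino ?x (y + 1) \<inter> \<Union>?E = {}"
  proof -
    have "(?x, y + 1) \<notin> \<Union>?E" "(?x + 1, y + 1) \<notin> \<Union>?E"
      unfolding Union_Un_distrib Un_iff cell_in_row using height by fastforce+
    then show ?thesis by (auto simp: domino_def)
  qed
  ultimately have "domino_tower (Suc (n + j)) k (insert (domino ?x (y + 1)) ?E)"
    using Suc by (intro domino_tower.place) auto
  moreover have "row (l + d) (y + 1) (Suc j) = insert (domino ?x (y + 1)) (row (l + d) (y + 1) j)"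
    by (simp add: row_def lessThan_Suc)
  ultimately show ?case by simp
qed

text \<open>Stated for an arbitrary part \<open>D\<close> already built, so that the induction along
  the chain can absorb one row after the other into \<open>D\<close>.\<close>

lemma stack_extends_tower:
  assumes "chain p q m zs" "partial_tower p q l y m (\<Union>D)" "domino_tower n k D" "row l y m \<subseteq> D" "1 \<le> m"
  shows "domino_tower (n + sum_list (map snd zs)) k (D \<union> stack l y m zs) \<and>
    convex_polyomino (\<Union>(D \<union> stack l y m zs))"
  using assms
proof (induction p q m zs arbitrary: l y n D rule: chain.induct)
  case (1 p q m)
  then have "D \<union> stack l y m [] = D" by auto
  then show ?case using 1 by (simp add: partial_tower_def)
next
  case (2 p q m d m' zs)
  let ?E = "D \<union> row (l + d) (y + 1) m'"
  have height: "z \<le> y" if "(x, z) \<in> \<Union>D" for x z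
    using 2(3) that unfolding partial_tower_def by blast
  have "partial_tower (p \<and> d \<le> 0) (q \<and> 2 * int m \<le> d + 2 * int m') (l + d) (y + 1) m' (\<Union>?E)"
    using partial_tower_step[OF 2(3), of d m'] 2(2) by simp
  moreover have "domino_tower (n + m') k ?E"
    using domino_tower_add_row[OF 2(4,5) height, where p = p and q = q and d = d and m' = m' and j = m'] 2(2,6) by simp
  ultimately have "domino_tower (n + m' + sum_list (map snd zs)) k (?E \<union> stack (l + d) (y + 1) m' zs) \<and>
      convex_polyomino (\<Union>(?E \<union> stack (l + d) (y + 1) m' zs))"
    using 2(2) by (intro "2.IH") (auto simp: admissible_def)
  moreover have "row (l + d) (y + 1) m' \<subseteq> stack (l + d) (y + 1) m' zs"
    by (cases zs) auto
  then have "?E \<union> stack (l + d) (y + 1) m' zs = D \<union> stack l y m ((d, m') # zs)"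
    using 2(5) by auto
  ultimately show ?case by (simp add: add.assoc)
qed

lemma stack_convex_tower:
  assumes "chain True True k zs" "1 \<le> k"
  shows "domino_tower (k + sum_list (map snd zs)) k (stack l y k zs)"
    and "convex_polyomino (\<Union>(stack l y k zs))"
proof -
  have cell: "(x, z) \<in> \<Union>(row l y k) \<longleftrightarrow> z = y \<and> x \<in> {l..l + 2 * int k - 1}" for x z
    unfolding cell_in_row by auto
  have "consecutive {x. (x, z) \<in> \<Union>(row l y k)}" "consecutive {z. (x, z) \<in> \<Union>(row l y k)}" for x z
    unfolding cell consecutive_iff by (auto intro: finite_subset[of _ "{l..l + 2 * int k - 1}"])
  then have "partial_tower True True l y k (\<Union>(row l y k))"
    unfolding partial_tower_def convex_polyomino_def cell by auto
  moreover have "domino_tower k k (row l y k)"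
    using domino_tower.base[OF assms(2)] by (simp add: row_def)
  moreover have "row l y k \<subseteq> stack l y k zs" by (cases zs) auto
  ultimately show "domino_tower (k + sum_list (map snd zs)) k (stack l y k zs)"
    and "convex_polyomino (\<Union>(stack l y k zs))"
    using stack_extends_tower[OF assms(1), of l y "row l y k" k k] assms(2) by (simp_all add: Un_absorb1)
qed

section \<open>Every convex domino tower is an encoded one\<close>

lemma domino_tower_card: "domino_tower n k D \<Longrightarrow> finite D \<and> card D = n"
proof (induction rule: domino_tower.induct)
  case (base k x y)
  have "inj_on (\<lambda>i. domino (x + 2 * int i) y) {..<k}"
    by (auto simp: inj_on_def domino_eq_iff)
  then show ?case by (simp add: card_image)
next
  case (place n k D x y)
  have "domino x y \<notin> D" using place(2) by (auto simp: domino_def)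
  then show ?case using place by simp
qed

lemma domino_tower_dominoes: "domino_tower n k D \<Longrightarrow> c \<in> D \<Longrightarrow> \<exists>x y. c = domino x y"
  by (induction rule: domino_tower.induct) blast+

lemma domino_tower_disjoint:
  "domino_tower n k D \<Longrightarrow> domino x y \<in> D \<Longrightarrow> domino (x + 1) y \<notin> D"
proof (induction arbitrary: x rule: domino_tower.induct)
  case (base k u v)
  then show ?case by (auto simp: domino_eq_iff; presburger)
next
  case (place n k D u v)
  have "domino (u - 1) v \<notin> D" "domino (u + 1) v \<notin> D"
    using place(2) by (auto simp: domino_def)
  then show ?case using place by (auto simp: domino_eq_iff)
qed

text \<open>Replaces the order of placement by a static condition on the final set:
  \<open>y0\<close> is the height of the base, and every domino above it has a support.\<close>

lemma domino_tower_support: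
  "domino_tower n k D \<Longrightarrow> \<exists>y0. (\<exists>x. domino x y0 \<in> D) \<and> (\<forall>x y. domino x y \<in> D \<longrightarrow> y0 \<le> y \<and>
    (y0 < y \<longrightarrow> domino (x - 1) (y - 1) \<in> D \<or> domino x (y - 1) \<in> D \<or> domino (x + 1) (y - 1) \<in> D))"
proof (induction rule: domino_tower.induct)
  case (base k x y)
  then show ?case
    by (intro exI[of _ y] conjI exI[of _ x]) (auto simp: domino_eq_iff image_iff intro!: bexI[of _ 0])
next
  case (place n k D u v)
  from place.IH obtain y0 where y0: "\<exists>x. domino x y0 \<in> D" "\<And>x y. domino x y \<in> D \<Longrightarrow> y0 \<le> y"
    "\<And>x y. domino x y \<in> D \<Longrightarrow> y0 < y \<Longrightarrow>
      domino (x - 1) (y - 1) \<in> D \<or> domino x (y - 1) \<in> D \<or> domino (x + 1) (y - 1) \<in> D" by blast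
  \<comment> \<open>The support of the new domino lies at height at least \<open>y0\<close>, so
    nothing is ever added at the height of the base.\<close>
  have "y0 \<le> v - 1" using place(3) y0(2) by blast
  then show ?case using y0 place(3)
    by (intro exI[of _ y0]) (auto simp: domino_eq_iff)
qed

text \<open>\<open>R\<close> is the set of left cells of the dominoes in a row. The tiling is forced
  from left to right, starting at \<open>l\<close>.\<close>

lemma interval_tiling:
  fixes R :: "int set"
  assumes disj: "\<And>x. x \<in> R \<Longrightarrow> x + 1 \<notin> R" and cells: "{x. x \<in> R \<or> x - 1 \<in> R} = {l..r}"
  shows "R = (\<lambda>i. l + 2 * int i) ` {..<nat ((r - l + 2) div 2)}"
proof -
  have cell: "x \<in> R \<or> x - 1 \<in> R \<longleftrightarrow> l \<le> x \<and> x \<le> r" for x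
  proof -
    have "x \<in> {x. x \<in> R \<or> x - 1 \<in> R} \<longleftrightarrow> x \<in> {l..r}" unfolding cells ..
    then show ?thesis by simp
  qed
  \<comment> \<open>The cell two further right is covered; it is not the right half of a domino,
    because that domino would overlap the preceding one.\<close>
  have in_R: "l + 2 * int i \<in> R" if "l + 2 * int i \<le> r" for i
    using that
  proof (induction i)
    case 0
    then show ?case using cell[of l] cell[of "l - 1"] by simp
  next
    case (Suc i)
    then have "l + 2 * int i + 1 \<notin> R" using disj by simp
    then show ?case using Suc.prems cell[of "l + 2 * int (Suc i)"] by (simp add: algebra_simps)
  qed
  show ?thesis
  proof (intro equalityI subsetI)
    fix x assume x: "x \<in> R"
    then have lx: "l \<le> x" "x \<le> r" using cell by auto
    show "x \<in> (\<lambda>i. l + 2 * int i) ` {..<nat ((r - l + 2) div 2)}"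
    proof (cases "even (x - l)")
      case True
      then show ?thesis using lx by (intro image_eqI[of _ _ "nat ((x - l) div 2)"]) auto
    next
      case False
      then obtain i where "x - l = 2 * i + 1" by (rule oddE)
      then have "x = l + 2 * int (nat i) + 1" using lx by simp
      then show ?thesis using x disj in_R[of "nat i"] lx by simp
    qed
  next
    fix x assume "x \<in> (\<lambda>i. l + 2 * int i) ` {..<nat ((r - l + 2) div 2)}"
    then show "x \<in> R" using in_R by auto
  qed
qed

text \<open>\<open>L j\<close> and \<open>M j\<close> are the left end and the length of row
  \<open>j\<close>, and \<open>conv\<close> is convexity of columns. Along the chain the bits say
  exactly whether the ends of row \<open>j\<close> are extreme among the rows up to
  \<open>j\<close>.\<close>

lemma chain_of_profile:
  fixes L :: "nat \<Rightarrow> int" and M :: "nat \<Rightarrow> nat"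
  assumes pos: "\<And>j. j \<le> H \<Longrightarrow> 1 \<le> M j"
    and left: "\<And>j. j < H \<Longrightarrow> L j - 1 \<le> L (Suc j)"
    and right: "\<And>j. j < H \<Longrightarrow> L (Suc j) + 2 * int (M (Suc j)) \<le> L j + 2 * int (M j) + 1"
    and conv: "\<And>i j k x. i < j \<Longrightarrow> j < k \<Longrightarrow> k \<le> H \<Longrightarrow> x \<in> {L i..<L i + 2 * int (M i)} \<Longrightarrow>
      x \<in> {L k..<L k + 2 * int (M k)} \<Longrightarrow> x \<in> {L j..<L j + 2 * int (M j)}"
    and "j \<le> H"
  shows "chain (\<forall>i\<le>j. L j \<le> L i) (\<forall>i\<le>j. L i + 2 * int (M i) \<le> L j + 2 * int (M j)) (M j)
    (map (\<lambda>i. (L (Suc i) - L i, M (Suc i))) [j..<H])"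
  using \<open>j \<le> H\<close>
proof (induction j rule: inc_induct)
  case base
  then show ?case by simp
next
  case (step j)
  \<comment> \<open>A discrete intermediate value argument: the right end rises by at most one cell
    per row, so left ends cannot jump over a column without some row covering it.\<close>
  have occ_left: "\<exists>i'\<le>j. x \<in> {L i'..<L i' + 2 * int (M i')}"
    if "i \<le> j" "L i \<le> x" "x \<le> L j" "j \<le> H" for i j x
    using that
  proof (induction j rule: dec_induct)
    case base
    then show ?case using pos[of i] by (intro exI[of _ i]) auto
  next
    case (step j)
    show ?case
    proof (cases "x \<le> L j")
      case True
      then show ?thesis using step by (meson Suc_leD le_SucI)
    next
      case False
      then show ?thesis using step.prems right[of j] pos[of "Suc j"] by (intro exI[of _ j]) auto
    qed
  qed
  have occ_right: "\<exists>i'\<le>j. x \<in> {L i'..<L i' + 2 * int (M i')}"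
    if "i \<le> j" "x < L i + 2 * int (M i)" "L j + 2 * int (M j) \<le> x + 1" "j \<le> H" for i j x
    using that
  proof (induction j rule: dec_induct)
    case base
    then show ?case using pos[of i] by (intro exI[of _ i]) auto
  next
    case (step j)
    show ?case
    proof (cases "L j + 2 * int (M j) \<le> x + 1")
      case True
      then show ?thesis using step by (meson Suc_leD le_SucI)
    next
      case False
      then show ?thesis using step.prems left[of j] pos[of "Suc j"] by (intro exI[of _ j]) auto
    qed
  qed
  \<comment> \<open>Otherwise the column of the overhanging cell would be occupied in a row before
    \<open>j\<close> and in row \<open>Suc j\<close>, but not in row \<open>j\<close>, contradicting
    convexity.\<close>
  have p: "L j \<le> L i" if eq: "L (Suc j) = L j - 1" and i: "i \<le> j" for i
  proof (rule ccontr)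
    assume "\<not> L j \<le> L i"
    then obtain i' where i': "i' \<le> j" "L j - 1 \<in> {L i'..<L i' + 2 * int (M i')}"
      using occ_left[of i j "L j - 1"] i step.hyps by auto
    then have "i' < j" by (cases "i' = j") auto
    then show False using conv[of i' j "Suc j" "L j - 1"] i' eq step.hyps pos[of "Suc j"] by auto
  qed
  have q: "L i + 2 * int (M i) \<le> L j + 2 * int (M j)"
    if eq: "L (Suc j) + 2 * int (M (Suc j)) = L j + 2 * int (M j) + 1" and i: "i \<le> j" for i
  proof (rule ccontr)
    assume "\<not> L i + 2 * int (M i) \<le> L j + 2 * int (M j)"
    then obtain i' where i': "i' \<le> j" "L j + 2 * int (M j) \<in> {L i'..<L i' + 2 * int (M i')}"
      using occ_right[of i j "L j + 2 * int (M j)"] i step.hyps by auto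
    then have "i' < j" by (cases "i' = j") auto
    then show False
      using conv[of i' j "Suc j" "L j + 2 * int (M j)"] i' eq step.hyps pos[of "Suc j"] by auto
  qed
  \<comment> \<open>If the next row overhangs on the left, both sides hold by \<open>p\<close>.
    Otherwise \<open>L j \<le> L (Suc j)\<close>, and the next row is leftmost only if it starts at
    the same column as a leftmost row \<open>j\<close>.\<close>
  have "(\<forall>i\<le>Suc j. L (Suc j) \<le> L i) \<longleftrightarrow> (\<forall>i\<le>j. L j \<le> L i) \<and> L (Suc j) - L j \<le> 0"
  proof (cases "L (Suc j) = L j - 1")
    case True
    then show ?thesis using p by (force simp: le_Suc_eq)
  next
    case False
    then show ?thesis using left[of j] step.hyps by (force simp: le_Suc_eq)
  qed
  moreover have "(\<forall>i\<le>Suc j. L i + 2 * int (M i) \<le> L (Suc j) + 2 * int (M (Suc j))) \<longleftrightarrow>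
      (\<forall>i\<le>j. L i + 2 * int (M i) \<le> L j + 2 * int (M j)) \<and>
      2 * int (M j) \<le> L (Suc j) - L j + 2 * int (M (Suc j))"
  proof (cases "L (Suc j) + 2 * int (M (Suc j)) = L j + 2 * int (M j) + 1")
    case True
    then show ?thesis using q by (force simp: le_Suc_eq)
  next
    case False
    then show ?thesis using right[of j] step.hyps by (force simp: le_Suc_eq)
  qed
  moreover have "admissible (\<forall>i\<le>j. L j \<le> L i) (\<forall>i\<le>j. L i + 2 * int (M i) \<le> L j + 2 * int (M j)) (M j)
      (L (Suc j) - L j) (M (Suc j))"
    using p q left[of j] right[of j] pos[of "Suc j"] step.hyps by (auto simp: admissible_def)
  ultimately show ?case
    using step.IH step.hyps by (simp add: upt_conv_Cons)
qed

text \<open>The relative shifts telescope to the absolute left ends \<open>L i\<close>.\<close>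

lemma stack_of_profile:
  "j \<le> H \<Longrightarrow> stack (L j) (y + int j) (M j) (map (\<lambda>i. (L (Suc i) - L i, M (Suc i))) [j..<H]) =
    (\<Union>i\<in>{j..H}. row (L i) (y + int i) (M i))"
proof (induction j rule: inc_induct)
  case (step j)
  then have "{j..H} = insert j {Suc j..H}" by auto
  moreover have "y + int j + 1 = y + int (Suc j)" by simp
  ultimately show ?case using step by (simp only: upt_conv_Cons list.map stack.simps) simp
qed simp

lemma convex_tower_rows:
  assumes D: "domino_tower n k D" and conv: "convex_polyomino (\<Union>D)"
  shows "\<exists>l m. \<forall>x. domino x y \<in> D \<longleftrightarrow> domino x y \<in> row l y m"
proof -
  have cell: "(x, y) \<in> \<Union>D \<longleftrightarrow> domino x y \<in> D \<or> domino (x - 1) y \<in> D" for x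
  proof
    assume "(x, y) \<in> \<Union>D"
    then obtain c where c: "c \<in> D" "(x, y) \<in> c" by (rule UnionE)
    moreover obtain x' y' where "c = domino x' y'" using domino_tower_dominoes[OF D c(1)] by blast
    ultimately show "domino x y \<in> D \<or> domino (x - 1) y \<in> D" by (auto simp: domino_def)
  next
    have "(x, y) \<in> domino x y" "(x, y) \<in> domino (x - 1) y" by (simp_all add: domino_def)
    then show "domino x y \<in> D \<or> domino (x - 1) y \<in> D \<Longrightarrow> (x, y) \<in> \<Union>D" by blast
  qed
  have "consecutive {x. (x, y) \<in> \<Union>D}" using conv unfolding convex_polyomino_def by blast
  then obtain l r where "{x. domino x y \<in> D \<or> domino (x - 1) y \<in> D} = {l..r}"
    unfolding cell consecutive_def by blast
  then have "{x. domino x y \<in> D} = (\<lambda>i. l + 2 * int i) ` {..<nat ((r - l + 2) div 2)}"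
    by (intro interval_tiling) (use domino_tower_disjoint[OF D] in auto)
  then show ?thesis unfolding domino_in_row by blast
qed

text \<open>The profile \<open>L\<close>, \<open>M\<close> is chosen at all heights from the base
  upwards, with \<open>M j = 0\<close> at empty ones; \<open>H\<close> is the last nonempty
  row.\<close>

lemma convex_tower_is_stack:
  assumes D: "domino_tower n k D" and conv: "convex_polyomino (\<Union>D)"
  shows "\<exists>l y m zs. D = stack l y m zs \<and> 1 \<le> m \<and> chain True True m zs"
proof -
  obtain y0 where ne: "\<exists>x. domino x y0 \<in> D" and ge: "\<And>x y. domino x y \<in> D \<Longrightarrow> y0 \<le> y"
    and supp: "\<And>x y. domino x y \<in> D \<Longrightarrow> y0 < y \<Longrightarrow>
      domino (x - 1) (y - 1) \<in> D \<or> domino x (y - 1) \<in> D \<or> domino (x + 1) (y - 1) \<in> D"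
    using domino_tower_support[OF D] by blast
  have "\<exists>z. \<forall>x. domino x (y0 + int j) \<in> D \<longleftrightarrow> x \<in> (\<lambda>i. fst z + 2 * int i) ` {..<snd z}" for j
  proof -
    obtain l m where "\<forall>x. domino x (y0 + int j) \<in> D \<longleftrightarrow> domino x (y0 + int j) \<in> row l (y0 + int j) m"
      using convex_tower_rows[OF D conv] by blast
    then show ?thesis unfolding domino_in_row by (intro exI[of _ "(l, m)"]) simp
  qed
  then have "\<exists>f. \<forall>j x. domino x (y0 + int j) \<in> D \<longleftrightarrow> x \<in> (\<lambda>i. fst (f j) + 2 * int i) ` {..<snd (f j)}"
    by (intro choice) blast
  then obtain f :: "nat \<Rightarrow> int \<times> nat" where
    f: "domino x (y0 + int j) \<in> D \<longleftrightarrow> x \<in> (\<lambda>i. fst (f j) + 2 * int i) ` {..<snd (f j)}" for j x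
    by blast
  define L M where "L = fst \<circ> f" and "M = snd \<circ> f"
  have rows: "domino x (y0 + int j) \<in> D \<longleftrightarrow> x \<in> (\<lambda>i. L j + 2 * int i) ` {..<M j}" for j x
    using f by (simp add: L_def M_def)
  have first: "domino (L j) (y0 + int j) \<in> D" if "1 \<le> M j" for j
    using that unfolding rows by (auto intro!: image_eqI[of _ _ 0])
  have last: "domino (L j + 2 * int (M j) - 2) (y0 + int j) \<in> D" if "1 \<le> M j" for j
    using that unfolding rows by (auto intro!: image_eqI[of _ _ "M j - 1"] simp: of_nat_diff)
  have bounds: "L j \<le> x \<and> x \<le> L j + 2 * int (M j) - 2" if "domino x (y0 + int j) \<in> D" for j x
    using that unfolding rows by auto
  have M0: "1 \<le> M 0" using ne rows[of _ 0] by auto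
  have supp': "\<exists>x'. domino x' (y0 + int j) \<in> D \<and> \<bar>x' - x\<bar> \<le> 1" if "domino x (y0 + int (Suc j)) \<in> D" for x j
  proof -
    have "y0 + int (Suc j) - 1 = y0 + int j" by simp
    then have "domino (x - 1) (y0 + int j) \<in> D \<or> domino x (y0 + int j) \<in> D \<or> domino (x + 1) (y0 + int j) \<in> D"
      using supp[OF that] by simp
    then show ?thesis by force
  qed
  \<comment> \<open>A nonempty row needs support from the row below, so the nonempty rows form an
    initial segment.\<close>
  have down: "1 \<le> M j" if "1 \<le> M (Suc j)" for j
    using supp'[OF first[OF that]] bounds by force
  have down': "1 \<le> M i" if "i \<le> j" "1 \<le> M j" for i j
    using that by (induction rule: inc_induct) (use down in simp_all)
  define J where "J = {j. 1 \<le> M j}"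
  have "(\<lambda>j. domino (L j) (y0 + int j)) ` J \<subseteq> D" "inj_on (\<lambda>j. domino (L j) (y0 + int j)) J"
    using first by (auto simp: J_def inj_on_def domino_eq_iff)
  then have J: "finite J" using domino_tower_card[OF D] by (metis finite_imageD finite_subset)
  have "0 \<in> J" using M0 by (simp add: J_def)
  define H where "H = Max J"
  have "H \<in> J" using J \<open>0 \<in> J\<close> unfolding H_def by (intro Max_in) blast+
  moreover have "j \<le> H" if "j \<in> J" for j using J that by (simp add: H_def)
  ultimately have H: "1 \<le> M j \<longleftrightarrow> j \<le> H" for j using down'[of j H] by (auto simp: J_def)
  have D_eq: "D = (\<Union>i\<in>{0..H}. row (L i) (y0 + int i) (M i))"
  proof (intro equalityI subsetI)
    fix c assume c: "c \<in> D"
    then obtain x y where xy: "c = domino x y" using domino_tower_dominoes[OF D] by blast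
    define j where "j = nat (y - y0)"
    have y: "y = y0 + int j" using ge c xy by (simp add: j_def)
    then have "c \<in> row (L j) (y0 + int j) (M j)" using c xy rows by (simp add: domino_in_row)
    moreover have "j \<le> H" using bounds[of x j] c xy y H[of j] by auto
    ultimately show "c \<in> (\<Union>i\<in>{0..H}. row (L i) (y0 + int i) (M i))" by auto
  next
    fix c assume "c \<in> (\<Union>i\<in>{0..H}. row (L i) (y0 + int i) (M i))"
    then show "c \<in> D" using rows by (auto simp: row_def)
  qed
  have cell: "(x, y0 + int j) \<in> \<Union>D \<longleftrightarrow> x \<in> {L j..<L j + 2 * int (M j)}" for x j
  proof -
    have "(x, y0 + int j) \<in> \<Union>D \<longleftrightarrow> (\<exists>i\<le>H. (x, y0 + int j) \<in> \<Union>(row (L i) (y0 + int i) (M i)))"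
      unfolding D_eq by auto
    also have "\<dots> \<longleftrightarrow> j \<le> H \<and> x \<in> {L j..<L j + 2 * int (M j)}"
      unfolding cell_in_row by auto
    also have "\<dots> \<longleftrightarrow> x \<in> {L j..<L j + 2 * int (M j)}" using H[of j] by auto
    finally show ?thesis .
  qed
  let ?zs = "map (\<lambda>i. (L (Suc i) - L i, M (Suc i))) [0..<H]"
  have "chain (\<forall>i\<le>0. L 0 \<le> L i) (\<forall>i\<le>0. L i + 2 * int (M i) \<le> L 0 + 2 * int (M 0)) (M 0) ?zs"
  proof (rule chain_of_profile)
    show "1 \<le> M j" if "j \<le> H" for j using H that by simp
    \<comment> \<open>The support of the first domino starts at most one cell further right than
      that domino; the last domino gives the bound on the right in the same way.\<close>
    show "L j - 1 \<le> L (Suc j)" if "j < H" for j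
      using supp'[OF first[of "Suc j"]] bounds[of _ j] H[of "Suc j"] that by force
    show "L (Suc j) + 2 * int (M (Suc j)) \<le> L j + 2 * int (M j) + 1" if "j < H" for j
      using supp'[OF last[of "Suc j"]] bounds[of _ j] H[of "Suc j"] that by force
    show "x \<in> {L j..<L j + 2 * int (M j)}"
      if "i < j" "j < k" "k \<le> H" "x \<in> {L i..<L i + 2 * int (M i)}" "x \<in> {L k..<L k + 2 * int (M k)}"
      for i j k x
    proof -
      have "(x, y0 + int i) \<in> \<Union>D" "(x, y0 + int k) \<in> \<Union>D" unfolding cell using that by blast+
      moreover have "y0 + int i \<le> y0 + int j" "y0 + int j \<le> y0 + int k" using that by simp_all
      moreover have "consecutive {y. (x, y) \<in> \<Union>D}" using conv unfolding convex_polyomino_def by blast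
      ultimately have "(x, y0 + int j) \<in> \<Union>D" unfolding consecutive_iff by blast
      then show ?thesis unfolding cell .
    qed
  qed simp
  then have "chain True True (M 0) ?zs" by simp
  moreover have "D = stack (L 0) y0 (M 0) ?zs"
    using stack_of_profile[of 0 H L y0 M, folded D_eq] by simp
  ultimately show ?thesis using M0 by blast
qed

section \<open>Row lengths of an encoded tower\<close>

text \<open>Excludes the empty set, which the condition in \<open>row_length\<close> would count at
  every height.\<close>

lemma stack_nonempty: "c \<in> stack l y m zs \<Longrightarrow> c \<noteq> {}"
  by (induction l y m zs rule: stack.induct) (auto simp: row_def domino_def)

lemma dominoes_at_height_row:
  "{c \<in> row l y m. c \<subseteq> UNIV \<times> {z}} = (if z = y then row l y m else {})"
  by (auto simp: row_def domino_def)

lemma dominoes_below_stack: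
  assumes "z < y"
  shows "{c \<in> stack l y m zs. c \<subseteq> UNIV \<times> {z}} = {}"
proof -
  have False if c: "c \<in> stack l y m zs" "c \<subseteq> UNIV \<times> {z}" for c
  proof -
    obtain v where "v \<in> c" using stack_nonempty[OF c(1)] by blast
    then obtain x where "(x, z) \<in> c" using c(2) by blast
    then have "(x, z) \<in> \<Union>(stack l y m zs)" using c(1) by blast
    then show False using cell_in_stack_height[of x z l y m zs] assms by linarith
  qed
  then show ?thesis by blast
qed

lemma row_length_row: "row_length (row l y m) y = m"
proof -
  have "inj_on (\<lambda>i. domino (l + 2 * int i) y) {..<m}" by (simp add: inj_on_def domino_eq_iff)
  then show ?thesis unfolding row_length_def dominoes_at_height_row by (simp add: row_def card_image)
qed

lemma row_length_stack_Cons: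
  "row_length (stack l y m ((d, m') # zs)) y = m"
  "y < z \<Longrightarrow> row_length (stack l y m ((d, m') # zs)) z = row_length (stack (l + d) (y + 1) m' zs) z"
proof -
  have split: "{c \<in> stack l y m ((d, m') # zs). c \<subseteq> UNIV \<times> {z}} =
      {c \<in> row l y m. c \<subseteq> UNIV \<times> {z}} \<union> {c \<in> stack (l + d) (y + 1) m' zs. c \<subseteq> UNIV \<times> {z}}" for z
    unfolding stack.simps by blast
  show "row_length (stack l y m ((d, m') # zs)) y = m"
    using row_length_row[of l y m] unfolding row_length_def split
    by (simp add: dominoes_below_stack)
  show "row_length (stack l y m ((d, m') # zs)) z = row_length (stack (l + d) (y + 1) m' zs) z"
    if "y < z" using that unfolding row_length_def split dominoes_at_height_row by simp
qed

lemma heights_stack_Cons: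
  assumes "1 \<le> m"
  shows "snd ` \<Union>(stack l y m ((d, m') # zs)) = insert y (snd ` \<Union>(stack (l + d) (y + 1) m' zs))"
proof -
  have "snd ` \<Union>(row l y m) = {y}"
  proof (intro equalityI subsetI)
    fix z assume "z \<in> {y}"
    moreover have "(l, y) \<in> \<Union>(row l y m)" unfolding cell_in_row using assms by simp
    ultimately show "z \<in> snd ` \<Union>(row l y m)" by (metis image_eqI singletonD snd_conv)
  next
    fix z assume "z \<in> snd ` \<Union>(row l y m)"
    then obtain x where "(x, z) \<in> \<Union>(row l y m)" by (metis imageE prod.collapse)
    then show "z \<in> {y}" unfolding cell_in_row by simp
  qed
  then show ?thesis unfolding stack.simps Union_Un_distrib image_Un by simp
qed

text \<open>Only heights that carry cells enter the maximum, and with positive lengths these are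
  exactly the heights of the coded rows.\<close>

lemma row_lengths_stack:
  assumes "1 \<le> m" "\<And>z. z \<in> set zs \<Longrightarrow> 1 \<le> snd z"
  shows "row_length (stack l y m zs) ` snd ` \<Union>(stack l y m zs) = insert m (snd ` set zs)"
  using assms
proof (induction l y m zs rule: stack.induct)
  case (1 l y m)
  have "snd ` \<Union>(stack l y m []) = {y}"
  proof (intro equalityI subsetI)
    fix z assume "z \<in> {y}"
    moreover have "(l, y) \<in> \<Union>(stack l y m [])" unfolding cell_in_stack_bottom using 1 by simp
    ultimately show "z \<in> snd ` \<Union>(stack l y m [])" by (metis image_eqI singletonD snd_conv)
  next
    fix z assume "z \<in> snd ` \<Union>(stack l y m [])"
    then obtain x where "(x, z) \<in> \<Union>(stack l y m [])" by (metis imageE prod.collapse)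
    then show "z \<in> {y}" unfolding stack.simps cell_in_row by simp
  qed
  then show ?case by (simp only: stack.simps image_insert image_empty row_length_row set_simps)
next
  case (2 l y m d m' zs)
  let ?S = "stack (l + d) (y + 1) m' zs"
  have "row_length (stack l y m ((d, m') # zs)) z = row_length ?S z" if z: "z \<in> snd ` \<Union>?S" for z
  proof (rule row_length_stack_Cons(2))
    obtain v where v: "z = snd v" "v \<in> \<Union>?S" using z by (rule imageE)
    then have "y + 1 \<le> snd v"
      using cell_in_stack_height[of "fst v" "snd v" "l + d" "y + 1" m' zs] unfolding prod.collapse by blast
    then show "y < z" using v(1) by simp
  qed
  then have "row_length (stack l y m ((d, m') # zs)) ` snd ` \<Union>?S = row_length ?S ` snd ` \<Union>?S"
    by (rule image_cong[OF refl])
  also have "\<dots> = insert m' (snd ` set zs)"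
    using 2(3)[of "(d, m')"] 2(3) by (intro 2(1)) simp_all
  finally show ?case
    unfolding heights_stack_Cons[OF 2(2)] image_insert row_length_stack_Cons(1) by simp
qed

lemma max_row_length_stack:
  assumes "1 \<le> k" "chain p q k zs"
  shows "max_row_length (stack l y k zs) = Max (insert k (snd ` set zs))"
  unfolding max_row_length_def using assms by (subst row_lengths_stack) (auto dest: chain_pos)

section \<open>Translation classes correspond to codes\<close>

lemma convex_towers_eq:
  "convex_towers b n = {\<Union>(stack l y k zs) | l y k zs. (k, zs) \<in> codes b n}"
proof (intro equalityI subsetI)
  fix P assume "P \<in> convex_towers b n"
  then obtain D k' where P: "P = \<Union>D" and D: "domino_tower n k' D" and conv: "convex_polyomino (\<Union>D)"
    and b: "max_row_length D = b" unfolding convex_towers_def by blast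
  obtain l y k zs where S: "D = stack l y k zs" "1 \<le> k" "chain True True k zs"
    using convex_tower_is_stack[OF D conv] by blast
  \<comment> \<open>The given derivation and the one obtained from the code are compared through the
    number of dominoes in \<open>D\<close>.\<close>
  have "card D = n" using domino_tower_card[OF D] by blast
  moreover have "card D = k + sum_list (map snd zs)"
    using domino_tower_card[OF stack_convex_tower(1)[OF S(3,2)]] S(1) by blast
  ultimately have "(k, zs) \<in> codes b n"
    using S b max_row_length_stack[OF S(2,3), of l y] by (simp add: codes_def)
  then show "P \<in> {\<Union>(stack l y k zs) | l y k zs. (k, zs) \<in> codes b n}"
    unfolding P S(1) by blast
next
  fix P assume "P \<in> {\<Union>(stack l y k zs) | l y k zs. (k, zs) \<in> codes b n}"
  then obtain l y k zs where P: "P = \<Union>(stack l y k zs)" and c: "(k, zs) \<in> codes b n" by blast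
  then have k: "1 \<le> k" "chain True True k zs" "k + sum_list (map snd zs) = n"
    "Max (insert k (snd ` set zs)) = b"
    unfolding codes_def by blast+
  have "domino_tower n k (stack l y k zs)" "convex_polyomino (\<Union>(stack l y k zs))"
    using stack_convex_tower[OF k(2,1)] k(3) by blast+
  moreover have "max_row_length (stack l y k zs) = b"
    using max_row_length_stack[OF k(1,2), of l y] k(4) by simp
  ultimately show "P \<in> convex_towers b n" unfolding P convex_towers_def by blast
qed

lemma translation_class_stack:
  "translation_equiv `` {\<Union>(stack l y k zs)} = {\<Union>(stack l' y' k zs) | l' y'. True}"
proof (intro equalityI subsetI)
  fix Q assume "Q \<in> translation_equiv `` {\<Union>(stack l y k zs)}"
  then obtain v where "Q = (+) v ` \<Union>(stack l y k zs)" unfolding translation_equiv_def by blast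
  moreover obtain a c where "v = (a, c)" by (cases v)
  ultimately have "Q = \<Union>(stack (l + a) (y + c) k zs)" by (simp only: translate_stack)
  then show "Q \<in> {\<Union>(stack l' y' k zs) | l' y'. True}" by blast
next
  fix Q assume "Q \<in> {\<Union>(stack l' y' k zs) | l' y'. True}"
  then obtain l' y' where "Q = \<Union>(stack l' y' k zs)" by blast
  then have "Q = (+) (l' - l, y' - y) ` \<Union>(stack l y k zs)"
    unfolding translate_stack by simp
  then show "Q \<in> translation_equiv `` {\<Union>(stack l y k zs)}"
    unfolding translation_equiv_def by blast
qed

text \<open>\<open>cls\<close> sends a code to all its positions in the plane, which is a single
  translation class. It is injective because \<open>stack_inj\<close> recovers the code from the
  cells.\<close>

lemma num_convex_towers_eq_card_codes: "num_convex_towers b n = card (codes b n)"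
proof -
  define cls where "cls = (\<lambda>(k, zs). {\<Union>(stack l y k zs) | l y. True})"
  have "convex_towers b n // translation_equiv = cls ` codes b n"
  proof (intro equalityI subsetI)
    fix C assume "C \<in> convex_towers b n // translation_equiv"
    then obtain P where "P \<in> convex_towers b n" "C = translation_equiv `` {P}" by (rule quotientE)
    then obtain l y k zs where "(k, zs) \<in> codes b n" "C = translation_equiv `` {\<Union>(stack l y k zs)}"
      unfolding convex_towers_eq by blast
    then have "C = cls (k, zs)" "(k, zs) \<in> codes b n"
      unfolding translation_class_stack cls_def by simp_all
    then show "C \<in> cls ` codes b n" by blast
  next
    fix C assume "C \<in> cls ` codes b n"
    then obtain k zs where c: "(k, zs) \<in> codes b n" "C = cls (k, zs)" by (metis imageE prod.collapse)
    then have "C = translation_equiv `` {\<Union>(stack 0 0 k zs)}"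
      unfolding translation_class_stack cls_def by simp
    moreover have "\<Union>(stack 0 0 k zs) \<in> convex_towers b n"
      unfolding convex_towers_eq using c(1) by blast
    ultimately show "C \<in> convex_towers b n // translation_equiv" by (simp only: quotientI)
  qed
  moreover have "inj_on cls (codes b n)"
  proof (rule inj_onI)
    fix c c' assume c: "c \<in> codes b n" and c': "c' \<in> codes b n" and eq: "cls c = cls c'"
    obtain k zs k' zs' where kz: "c = (k, zs)" "c' = (k', zs')" by (cases c, cases c')
    have "\<Union>(stack 0 0 k zs) \<in> cls c" unfolding kz cls_def case_prod_conv by blast
    then have "\<Union>(stack 0 0 k zs) \<in> cls c'" unfolding eq .
    then obtain l y where "\<Union>(stack 0 0 k zs) = \<Union>(stack l y k' zs')"
      unfolding kz cls_def case_prod_conv by blast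
    then have "0 = l \<and> 0 = y \<and> k = k' \<and> zs = zs'"
      by (rule stack_inj) (use c c' in \<open>auto simp: kz codes_def dest: chain_pos\<close>)
    then show "c = c'" by (simp add: kz)
  qed
  ultimately show ?thesis by (simp add: num_convex_towers_def card_image)
qed

theorem proposition3p1:
  fixes b :: nat
  assumes "b > 1"
  shows "\<exists>\<theta>::real. \<theta> \<noteq> 0 \<and>
    (\<lambda>n. real (num_convex_towers b n)) \<sim>[at_top] (\<lambda>n. \<theta> * 2 ^ n)"
  unfolding num_convex_towers_eq_card_codes using assms by (rule codes_asymptotics)

end
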